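(* For all non-negative integers $n,m,p,q$ and all complex numbers $z,w,\gamma,c$, $$H_{n,m}^{(p,q)}(z,w|c\gamma)=n!\,m!\sum_{k=0}^{\lfloor n/p\rfloor\wedge\lfloor m/q\rfloor}\frac{(c-1)^{k}\gamma^k}{k!}\,\frac{H_{n-pk,m-qk}^{(p,q)}(z,w|\gamma)}{(n-pk)!\,(m-qk)!}.$$
   Context: For non-negative integers $n,m,p,q$ and complex $z,w,\gamma$, $$H_{n,m}^{(p,q)}(z,w|\gamma)= n!\,m!\sum_{k=0}^{\lfloor n/p\rfloor\wedge\lfloor m/q\rfloor}\frac{\gamma^k}{k!}\frac{z^{n-pk}}{(n-pk)!}\frac{w^{m-qk}}{(m-qk)!},$$ where $a\wedge b=\min\{a,b\}$ and $\lfloor j/0\rfloor=+\infty$ by convention (so for $p=q=0$ such a sum is an infinite series and $H_{n,m}^{(0,0)}(z,w|\gamma)=e^{\gamma}z^nw^m$); $0^0=1$. *)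

theory Defs
  imports "HOL-Analysis.Analysis" "HOL-Library.Extended_Nat"
begin

text \<open>The quotient \<open>\<lfloor>j/d\<rfloor>\<close> with the convention \<open>\<lfloor>j/0\<rfloor> = \<infinity>\<close>
  (plain \<open>div\<close> would give \<open>j div 0 = 0\<close>).\<close>

definition floor_quot :: "nat \<Rightarrow> nat \<Rightarrow> enat" where
  "floor_quot j d = (if d = 0 then \<infinity> else enat (j div d))"

text \<open>The summation range \<open>0 \<le> k \<le> \<lfloor>n/p\<rfloor> \<and> \<lfloor>m/q\<rfloor>\<close>; it is all of \<open>\<nat>\<close> exactly when \<open>p = q = 0\<close>,
  and finite otherwise.\<close>

definition sum_range :: "nat \<Rightarrow> nat \<Rightarrow> nat \<Rightarrow> nat \<Rightarrow> nat set" where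
  "sum_range p q n m = {k. enat k \<le> min (floor_quot n p) (floor_quot m q)}"

text \<open>\<open>infsum\<close> covers both cases: it is the ordinary sum over a finite range and the sum of an
  absolutely convergent series for \<open>p = q = 0\<close> (see \<open>H_summable\<close> and \<open>H_0_0\<close>).\<close>

definition H :: "nat \<Rightarrow> nat \<Rightarrow> nat \<Rightarrow> nat \<Rightarrow> complex \<Rightarrow> complex \<Rightarrow> complex \<Rightarrow> complex" where
  "H p q n m z w \<gamma> =
     fact n * fact m *
     (\<Sum>\<^sub>\<infinity>k\<in>sum_range p q n m.
        \<gamma> ^ k / fact k * (z ^ (n - p * k) / fact (n - p * k)) * (w ^ (m - q * k) / fact (m - q * k)))"

lemma floor_quot_iff: "enat k \<le> floor_quot j d \<longleftrightarrow> d * k \<le> j"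
  by (cases "d = 0") (auto simp: floor_quot_def less_eq_div_iff_mult_less_eq mult.commute)

lemma mem_sum_range_iff: "k \<in> sum_range p q n m \<longleftrightarrow> p * k \<le> n \<and> q * k \<le> m"
  by (simp add: sum_range_def floor_quot_iff)

lemma sum_range_0_0: "sum_range 0 0 n m = UNIV"
  by (auto simp: mem_sum_range_iff)

lemma finite_sum_range:
  assumes "p \<noteq> 0 \<or> q \<noteq> 0"
  shows "finite (sum_range p q n m)"
proof (rule finite_subset)
  show "sum_range p q n m \<subseteq> {..max n m}"
  proof
    fix k assume "k \<in> sum_range p q n m"
    then have "p * k \<le> n" "q * k \<le> m" by (auto simp: mem_sum_range_iff)
    moreover have "k \<le> p * k \<or> k \<le> q * k" using assms by auto
    ultimately have "k \<le> n \<or> k \<le> m" by (meson le_trans)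
    then show "k \<in> {..max n m}" by auto
  qed
qed simp

lemma exp_has_sum: "((\<lambda>k. x ^ k / fact k) has_sum exp x) (UNIV :: nat set)" for x :: complex
proof -
  have "(\<lambda>k. x ^ k / fact k) sums exp x"
    using exp_converges[of x] by (simp add: scaleR_conv_of_real field_simps)
  moreover have "summable (\<lambda>k. norm (x ^ k / fact k))"
    using summable_norm_exp[of x] by (simp add: scaleR_conv_of_real field_simps)
  ultimately show ?thesis
    by (intro norm_summable_imp_has_sum)
qed

lemma H_summable:
  "(\<lambda>k. \<gamma> ^ k / fact k * (z ^ (n - p * k) / fact (n - p * k)) * (w ^ (m - q * k) / fact (m - q * k)))
     summable_on sum_range p q n m" for z w \<gamma> :: complex
proof (cases "p = 0 \<and> q = 0")
  case True
  have "(\<lambda>k. \<gamma> ^ k / fact k * (z ^ n / fact n) * (w ^ m / fact m)) summable_on (UNIV :: nat set)"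
    by (intro summable_on_cmult_left has_sum_imp_summable[OF exp_has_sum])
  with True show ?thesis by (simp add: sum_range_0_0)
next
  case False
  then show ?thesis by (intro summable_on_finite finite_sum_range) auto
qed

lemma H_0_0: "H 0 0 n m z w \<gamma> = exp \<gamma> * z ^ n * w ^ m"
proof -
  have "((\<lambda>k. \<gamma> ^ k / fact k * (z ^ n / fact n) * (w ^ m / fact m)) has_sum
          exp \<gamma> * (z ^ n / fact n) * (w ^ m / fact m)) UNIV"
    by (intro has_sum_cmult_left exp_has_sum)
  from infsumI[OF this] have "H 0 0 n m z w \<gamma> =
      fact n * fact m * (exp \<gamma> * (z ^ n / fact n) * (w ^ m / fact m))"
    by (simp add: H_def sum_range_0_0)
  then show ?thesis by simp
qed

end

(* With x = (c - 1) \<gamma> and y = \<gamma>, expanding the polynomials H on the right-hand side and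
   collecting the terms with k + j = l turns the double sum over (k, j) into the binomial expansion
   of (x + y) ^ l / l!, where x + y = c \<gamma>. For p = q = 0 the claim is exp (x + y) = exp x * exp y. *)

theory Submission
  imports Defs
begin

lemma binomial_exp_coeff:
  fixes x y :: "'a::field_char_0"
  shows "(\<Sum>k\<le>l. x ^ k / fact k * (y ^ (l - k) / fact (l - k))) = (x + y) ^ l / fact l"
proof -
  have "(x + y) ^ l = (\<Sum>k\<le>l. fact l * (x ^ k / fact k * (y ^ (l - k) / fact (l - k))))"
    unfolding binomial_ring by (intro sum.cong) (auto simp: binomial_fact)
  then show ?thesis
    by (simp only: sum_distrib_left [symmetric]) simp
qed

text \<open>The weight \<open>f\<close> sees only l = k + j. Since \<open>A\<close> is closed
  downwards, for each l in \<open>A\<close> the index k runs through all of 0..l, so the coefficient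
  of \<open>f l\<close> is a complete binomial sum.\<close>

lemma sum_exp_coeff_mult_add:
  fixes x y :: "'a::field_char_0"
  assumes "finite A" and down: "\<And>k l. l \<in> A \<Longrightarrow> k \<le> l \<Longrightarrow> k \<in> A"
  shows "(\<Sum>k\<in>A. x ^ k / fact k * (\<Sum>j\<in>{j. k + j \<in> A}. y ^ j / fact j * f (k + j))) =
         (\<Sum>l\<in>A. (x + y) ^ l / fact l * f l)"
proof -
  have fin: "finite {j. k + j \<in> A}" for k
    by (rule finite_subset [OF _ \<open>finite A\<close>]) (auto intro: down)
  have "(\<Sum>k\<in>A. x ^ k / fact k * (\<Sum>j\<in>{j. k + j \<in> A}. y ^ j / fact j * f (k + j))) =
      (\<Sum>(k, j)\<in>(SIGMA k:A. {j. k + j \<in> A}). x ^ k / fact k * (y ^ j / fact j * f (k + j)))"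
    using fin \<open>finite A\<close> by (simp add: sum.Sigma sum_distrib_left)
  also have "\<dots> = (\<Sum>(l, k)\<in>(SIGMA l:A. {..l}).
      x ^ k / fact k * (y ^ (l - k) / fact (l - k)) * f l)"
    by (rule sum.reindex_bij_witness [where i = "\<lambda>(l, k). (k, l - k)" and j = "\<lambda>(k, j). (k + j, k)"])
       (auto intro: down)
  also have "\<dots> = (\<Sum>l\<in>A. (x + y) ^ l / fact l * f l)"
    using \<open>finite A\<close>
    \<comment> \<open>The deleted rules would absorb \<open>f l\<close> into a numerator; without
      them it stays a right factor that can be pulled out of the sum over k.\<close>
    by (simp add: sum.Sigma [symmetric] sum_distrib_right [symmetric] binomial_exp_coeff
      del: times_divide_eq_left times_divide_eq_right)
  finally show ?thesis .
qed

text \<open>The assumption makes both subtractions exact, so p * j \<le> n - p * k amounts to p * (k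
  + j) \<le> n, and likewise for q and m. This puts the range of the inner polynomial into the form
  needed for regrouping by k + j.\<close>

lemma sum_range_diff:
  assumes "k \<in> sum_range p q n m"
  shows "sum_range p q (n - p * k) (m - q * k) = {j. k + j \<in> sum_range p q n m}"
  using assms by (auto simp: mem_sum_range_iff algebra_simps)

lemma sum_range_downward:
  assumes "l \<in> sum_range p q n m" "k \<le> l"
  shows "k \<in> sum_range p q n m"
  using assms by (meson mem_sum_range_iff le_trans mult_le_mono2)

text \<open>\<open>infsum\<close> is 0 by default on families that are not summable; the first
  conjunct ensures that the right-hand side is a genuine sum even when p = q = 0.\<close>

theorem proposition5p1:
  fixes n m p q :: nat and z w \<gamma> c :: complex
  shows "(\<lambda>k. (c - 1) ^ k * \<gamma> ^ k / fact k *
              (H p q (n - p * k) (m - q * k) z w \<gamma> / (fact (n - p * k) * fact (m - q * k))))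
           summable_on sum_range p q n m
       \<and> H p q n m z w (c * \<gamma>) =
           fact n * fact m *
           (\<Sum>\<^sub>\<infinity>k\<in>sum_range p q n m.
              (c - 1) ^ k * \<gamma> ^ k / fact k *
              (H p q (n - p * k) (m - q * k) z w \<gamma> / (fact (n - p * k) * fact (m - q * k))))"
proof (cases "p = 0 \<and> q = 0")
  case True
  \<comment> \<open>Here the indices are not lowered, so the \<open>H\<close> factor is constant in
    k and an exponential series remains.\<close>
  have "((\<lambda>k. ((c - 1) * \<gamma>) ^ k / fact k * (H 0 0 n m z w \<gamma> / (fact n * fact m))) has_sum
          exp ((c - 1) * \<gamma>) * (H 0 0 n m z w \<gamma> / (fact n * fact m))) UNIV"
    by (intro has_sum_cmult_left exp_has_sum)
  moreover have "exp (c * \<gamma>) = exp ((c - 1) * \<gamma>) * exp \<gamma>"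
    by (simp add: exp_add [symmetric] algebra_simps)
  ultimately show ?thesis
    using True
    by (auto simp: sum_range_0_0 H_0_0 power_mult_distrib infsumI dest: has_sum_imp_summable)
next
  case False
  define A where "A = sum_range p q n m"
  have fin: "finite A"
    using False by (auto simp: A_def intro: finite_sum_range)
  \<comment> \<open>Lowering the degrees first by k and then by j gives n - p * (k + j) and m - q *
    (k + j), so the powers of z and w depend on l = k + j alone.\<close>
  define f where "f l = z ^ (n - p * l) / fact (n - p * l) * (w ^ (m - q * l) / fact (m - q * l))" for l
  have H_eq: "H p q (n - p * k) (m - q * k) z w \<gamma> / (fact (n - p * k) * fact (m - q * k)) =
      (\<Sum>j\<in>{j. k + j \<in> A}. \<gamma> ^ j / fact j * f (k + j))" if "k \<in> A" for k
  proof -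
    \<comment> \<open>Finiteness lets the \<open>infsum\<close> inside \<open>H\<close> become an
      ordinary sum; its factorial prefactor cancels against the denominator.\<close>
    have "finite {j. k + j \<in> A}"
      by (metis A_def False finite_sum_range sum_range_diff that)
    then show ?thesis
      using that by (simp add: H_def A_def sum_range_diff f_def distrib_left mult.assoc)
  qed
  have "(\<Sum>k\<in>A. (c - 1) ^ k * \<gamma> ^ k / fact k *
      (H p q (n - p * k) (m - q * k) z w \<gamma> / (fact (n - p * k) * fact (m - q * k)))) =
      (\<Sum>k\<in>A. ((c - 1) * \<gamma>) ^ k / fact k * (\<Sum>j\<in>{j. k + j \<in> A}. \<gamma> ^ j / fact j * f (k + j)))"
    by (intro sum.cong) (simp_all only: H_eq power_mult_distrib)
  also have "\<dots> = (\<Sum>l\<in>A. ((c - 1) * \<gamma> + \<gamma>) ^ l / fact l * f l)"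
    using fin by (rule sum_exp_coeff_mult_add) (auto simp: A_def intro: sum_range_downward)
  also have "(c - 1) * \<gamma> + \<gamma> = c * \<gamma>"
    by (simp add: algebra_simps)
  finally show ?thesis
    using fin by (simp add: H_def [of p q n m] A_def [symmetric] f_def mult.assoc)
qed

end
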